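(* Let $(M,d)$ be a compact metric space, let $\mu$ be a Borel probability measure on $M$, and let $k:M\times M\to[0,\infty)$ satisfy $k(p,q)=k(q,p)$ for all $p,q\in M$, $k(p,p)=0$ for all $p\in M$, and, for some $L>0$, $|k(p,s)-k(q,s)|\le L\,d(p,q)$ for all $p,q,s\in M$. For $b>0$ and Borel measurable $f\ge 0$ with $\int_M f\,d\mu=1$ define $$U[f](p)=\int_M k(p,q)f(q)\,d\mu(q),\qquad \mathcal{E}_b[f]=\int_M\Big\{\log f+\frac b2 U[f]\Big\}f\,d\mu .$$ Let $b_n\to\infty$ and let $g_n\ge 0$ with $\int_M g_n\,d\mu=1$ satisfy $\mathcal{E}_{b_n}[g_n]=\min_{f\ge0,\ \int_M f\,d\mu=1}\mathcal{E}_{b_n}[f]$. Then the sequence of measures $\nu_n=g_n\,d\mu$ has a subsequence that converges weakly to a Borel probability measure $\nu$ supported on a set $A\subseteq M$ such that $k(p,q)=0$ for all $p,q\in A$.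
   Context: The convention $0\log 0=0$ is used in the free energy $\mathcal{E}_b$. *)

theory Defs
  imports "HOL-Probability.Probability"
begin

definition admissible :: "'a::metric_space measure \<Rightarrow> ('a \<Rightarrow> real) \<Rightarrow> bool" where
  "admissible mu f \<longleftrightarrow> f \<in> borel_measurable mu \<and> (\<forall>x. 0 \<le> f x)
     \<and> (\<integral>\<^sup>+ x. ennreal (f x) \<partial>mu) = 1"

definition pot :: "'a measure \<Rightarrow> ('a \<Rightarrow> 'a \<Rightarrow> real) \<Rightarrow> ('a \<Rightarrow> real) \<Rightarrow> 'a \<Rightarrow> real" where
  "pot mu k f p = (\<integral> q. k p q * f q \<partial>mu)"

text \<open>Free energy E_b[f] = int (log f + b/2 U[f]) f dmu, with 0 log 0 = 0, as an extended
  real.  Since f log f \<ge> -1/e and mu is a probability measure, the entropy part equals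
  int (f log f + 1) dmu - 1, a well-defined value in (-\<infinity>, +\<infinity>].\<close>
definition energy :: "'a measure \<Rightarrow> ('a \<Rightarrow> 'a \<Rightarrow> real) \<Rightarrow> real \<Rightarrow> ('a \<Rightarrow> real) \<Rightarrow> ereal" where
  "energy mu k b f =
     enn2ereal (\<integral>\<^sup>+ x. ennreal ((if f x = 0 then 0 else f x * ln (f x)) + 1) \<partial>mu) - 1
     + ereal (b / 2) * ereal (\<integral> p. pot mu k f p * f p \<partial>mu)"

definition weak_conv :: "(nat \<Rightarrow> 'a::metric_space measure) \<Rightarrow> 'a measure \<Rightarrow> bool" where
  "weak_conv N \<nu> \<longleftrightarrow> (\<forall>h :: 'a \<Rightarrow> real. continuous_on UNIV h \<and> bounded (range h) \<longrightarrow>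
      (\<lambda>n. \<integral> x. h x \<partial>N n) \<longlonglongrightarrow> (\<integral> x. h x \<partial>\<nu>))"

end

theory Submission
  imports Defs
begin

text \<open>Testing the minimizer against the normalized indicator of a small ball around a point of the
  support of \<open>mu\<close>, whose entropy is finite and independent of \<open>b\<close>, shows that the double integral of
  \<open>k\<close> against \<open>\<nu>\<^sub>n\<close> tends to 0. If \<open>k p q > 0\<close> for two points of the support of a weak limit, then
  by Lipschitz continuity \<open>k\<close> dominates a positive multiple of a product of two tent functions around
  \<open>p\<close> and \<open>q\<close>, which keeps that double integral away from 0.\<close>

section \<open>Weak sequential compactness through a Borel code on the real line\<close>

text \<open>Total boundedness gives a finite cover by balls of radius \<open>1 / Suc n\<close> for
  every \<open>n\<close>, and \<open>B\<close> enumerates all these balls. Since each cover is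
  finite, the bound \<open>J\<close> is uniform in \<open>x\<close>: membership in finitely many
  \<open>B j\<close> locates a point up to \<open>\<epsilon>\<close>.\<close>

lemma compact_countable_fine_cover:
  assumes "compact (UNIV :: 'a::metric_space set)"
  obtains B :: "nat \<Rightarrow> 'a::metric_space set"
  where "\<And>j. open (B j)"
    and "\<And>\<epsilon>. \<epsilon> > 0 \<Longrightarrow> \<exists>J. \<forall>x. \<exists>j\<le>J. x \<in> B j \<and> B j \<subseteq> ball x \<epsilon>"
proof -
  have "\<exists>K::'a set. finite K \<and> UNIV \<subseteq> (\<Union>y\<in>K. ball y (1 / real (Suc n)))" for n
    using assms unfolding compact_eq_totally_bounded
    by (metis divide_pos_pos of_nat_0_less_iff zero_less_Suc zero_less_one)
  then obtain F :: "nat \<Rightarrow> 'a set" where fin: "\<And>n. finite (F n)"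
    and cov: "\<And>n. UNIV \<subseteq> (\<Union>y\<in>F n. ball y (1 / real (Suc n)))"
    by metis
  define S where "S = (\<Union>n. (\<lambda>y. ball y (1 / real (Suc n))) ` F n)"
  have cS: "countable S"
    unfolding S_def using fin by (intro countable_UN countableI_type countable_finite finite_imageI)
  \<comment> \<open>\<open>from_nat_into S\<close> has range \<open>S\<close> only if
    \<open>S\<close> is nonempty; this holds because the type is inhabited.\<close>
  have "F 0 \<noteq> {}"
  proof
    assume "F 0 = {}"
    then show False using cov[of 0] by simp
  qed
  then have neS: "S \<noteq> {}"
    unfolding S_def by auto
  define B where "B = from_nat_into S"
  have rB: "range B = S"
    unfolding B_def using cS neS by simp
  show ?thesis
  proof
    show "open (B j)" for j
    proof -
      have "B j \<in> S" using rB rangeI[of B j] by simp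
      then show ?thesis unfolding S_def by auto
    qed
    fix \<epsilon> :: real assume "\<epsilon> > 0"
    then obtain n where n: "inverse (real (Suc n)) < \<epsilon> / 2"
      using reals_Archimedean[of "\<epsilon> / 2"] by auto
    let ?G = "(\<lambda>y. ball y (1 / real (Suc n))) ` F n"
    have "finite ?G" "?G \<subseteq> B ` UNIV"
      using fin rB unfolding S_def by auto
    then obtain C where C: "finite C" "?G = B ` C"
      using finite_subset_image by meson
    then obtain J where J: "\<And>j. j \<in> C \<Longrightarrow> j \<le> J"
      using finite_nat_set_iff_bounded_le[of C] by blast
    have "\<exists>j\<le>J. x \<in> B j \<and> B j \<subseteq> ball x \<epsilon>" for x
    proof -
      obtain y where y: "y \<in> F n" "x \<in> ball y (1 / real (Suc n))"
        using cov[of n] by blast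
      then obtain j where j: "j \<in> C" "ball y (1 / real (Suc n)) = B j"
        using C(2) by (metis (no_types, lifting) imageE imageI)
      have "ball y (1 / real (Suc n)) \<subseteq> ball x \<epsilon>"
      proof
        fix z assume "z \<in> ball y (1 / real (Suc n))"
        then have "dist y z < \<epsilon>/2" "dist x y < \<epsilon>/2"
          using y n by (auto simp: inverse_eq_divide dist_commute)
        then show "z \<in> ball x \<epsilon>"
          using dist_triangle[of x z y] by simp
      qed
      then show ?thesis using j J y by metis
    qed
    then show "\<exists>J. \<forall>x. \<exists>j\<le>J. x \<in> B j \<and> B j \<subseteq> ball x \<epsilon>" by blast
  qed
qed

lemma summable_ternary:
  fixes e :: "nat \<Rightarrow> real"
  assumes "\<And>i. \<bar>e i\<bar> \<le> 1"
  shows "summable (\<lambda>i. e i / 3 ^ Suc i)"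
proof (rule summable_comparison_test)
  show "\<exists>N. \<forall>n\<ge>N. norm (e n / 3 ^ Suc n) \<le> (1/3) ^ n"
  proof (intro exI allI impI)
    fix n
    have "\<bar>e n\<bar> / 3 ^ Suc n \<le> 1 / 3 ^ n"
      using assms[of n] by (intro frac_le) auto
    then show "norm (e n / 3 ^ Suc n) \<le> (1/3) ^ n" by (simp add: power_divide abs_mult)
  qed
  show "summable (\<lambda>n. (1/3::real) ^ n)" by (simp add: summable_geometric)
qed

lemma abs_suminf_ternary_le:
  fixes e :: "nat \<Rightarrow> real"
  assumes "\<And>i. \<bar>e i\<bar> \<le> 1"
  shows "\<bar>\<Sum>i. e i / 3 ^ Suc i\<bar> \<le> 1 / 2"
proof -
  have sm: "(\<lambda>i. 1 / 3 * (1/3::real) ^ i) sums (1/2)"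
    using sums_mult[OF geometric_sums[of "1/3::real"], of "1/3"] by simp
  have "norm (\<Sum>i. e i / 3 ^ Suc i) \<le> (\<Sum>i. 1 / 3 * (1/3::real) ^ i)"
  proof (rule norm_suminf_le)
    show "summable (\<lambda>i. 1 / 3 * (1/3::real) ^ i)" using sm by (rule sums_summable)
    show "norm (e n / 3 ^ Suc n) \<le> 1 / 3 * (1/3) ^ n" for n
    proof -
      have "\<bar>e n\<bar> / 3 ^ Suc n \<le> 1 / 3 ^ Suc n"
        using assms[of n] by (intro divide_right_mono) auto
      then show ?thesis by (simp add: power_divide abs_mult)
    qed
  qed
  then show ?thesis using sums_unique[OF sm] by simp
qed

text \<open>The tail beyond position \<open>j\<close> is at most half of the leading term, so it
  cannot cancel it. Base 3 matters: the digits are differences of 0-1 digits, hence -1, 0 or 1, and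
  in base 2 the tail could cancel the leading term exactly.\<close>

lemma ternary_first_digit:
  fixes e :: "nat \<Rightarrow> real"
  assumes bd: "\<And>i. \<bar>e i\<bar> \<le> 1" and z: "\<And>i. i < j \<Longrightarrow> e i = 0" and j: "\<bar>e j\<bar> = 1"
  shows "1 / (2 * 3 ^ Suc j) \<le> \<bar>\<Sum>i. e i / 3 ^ Suc i\<bar>"
proof -
  let ?f = "\<lambda>i. e i / 3 ^ Suc i"
  have "suminf ?f = (\<Sum>n. ?f (n + Suc j)) + sum ?f {..<Suc j}"
    using suminf_split_initial_segment[OF summable_ternary[of e, OF bd]] by blast
  also have "sum ?f {..<Suc j} = ?f j"
    using z by simp
  also have "(\<Sum>n. ?f (n + Suc j)) = (\<Sum>n. e (n + Suc j) / 3 ^ Suc n) / 3 ^ Suc j"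
    using suminf_divide[OF summable_ternary[of "\<lambda>n. e (n + Suc j)", OF bd], of "3 ^ Suc j"]
    by (simp add: power_add mult_ac)
  finally have eq: "suminf ?f = (\<Sum>n. e (n + Suc j) / 3 ^ Suc n) / 3 ^ Suc j + e j / 3 ^ Suc j" .
  have "\<bar>(\<Sum>n. e (n + Suc j) / 3 ^ Suc n) / 3 ^ Suc j\<bar> \<le> (1/2) / 3 ^ Suc j"
  proof -
    have "\<bar>\<Sum>n. e (n + Suc j) / 3 ^ Suc n\<bar> / 3 ^ Suc j \<le> (1/2) / 3 ^ Suc j"
      by (intro divide_right_mono abs_suminf_ternary_le bd) simp
    then show ?thesis by (simp only: abs_divide power_abs abs_numeral)
  qed
  moreover have "\<bar>e j / 3 ^ Suc j\<bar> = 1 / 3 ^ Suc j" by (simp add: j abs_mult)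
  moreover have "1 / (2 * 3 ^ Suc j) = (1/2) / (3::real) ^ Suc j"
     "1 / 3 ^ Suc j = 2 * ((1/2) / (3::real) ^ Suc j)" by simp_all
  ultimately show ?thesis unfolding eq by linarith
qed

text \<open>The ternary digits of \<open>s x\<close> record which sets of the fine cover contain
  \<open>x\<close>. Such a code is Borel but in general not continuous; what is uniformly continuous
  is its inverse, because close codes agree in their first digits and hence in membership in the
  first cover sets.\<close>

lemma compact_Borel_code:
  assumes "compact (UNIV :: 'a::metric_space set)"
  obtains s :: "'a::metric_space \<Rightarrow> real"
  where "s \<in> borel_measurable borel" "\<And>x. \<bar>s x\<bar> \<le> 1 / 2"
    and "\<And>\<epsilon>. \<epsilon> > 0 \<Longrightarrow> \<exists>\<delta>>0. \<forall>x y. \<bar>s x - s y\<bar> < \<delta> \<longrightarrow> dist x y < \<epsilon>"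
proof -
  obtain B :: "nat \<Rightarrow> 'a set" where op: "\<And>j. open (B j)"
    and fine: "\<And>\<epsilon>. \<epsilon> > 0 \<Longrightarrow> \<exists>J. \<forall>x. \<exists>j\<le>J. x \<in> B j \<and> B j \<subseteq> ball x \<epsilon>"
    using compact_countable_fine_cover[OF assms] by blast
  define s :: "'a \<Rightarrow> real" where "s x = (\<Sum>j. indicator (B j) x / 3 ^ Suc j)" for x
  have ind: "\<bar>indicator (B j) x :: real\<bar> \<le> 1" for j x by (simp add: indicator_def)
  show ?thesis
  proof
    have [measurable]: "B j \<in> sets borel" for j using op by simp
    show "s \<in> borel_measurable borel" unfolding s_def by measurable
    show "\<bar>s x\<bar> \<le> 1 / 2" for x unfolding s_def using ind by (rule abs_suminf_ternary_le)
    fix \<epsilon> :: real assume "\<epsilon> > 0"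
    then obtain J where J: "\<And>x. \<exists>j\<le>J. x \<in> B j \<and> B j \<subseteq> ball x \<epsilon>"
      using fine by blast
    show "\<exists>\<delta>>0. \<forall>x y. \<bar>s x - s y\<bar> < \<delta> \<longrightarrow> dist x y < \<epsilon>"
    proof (intro exI conjI allI impI)
      \<comment> \<open>Codes that differ at some digit of index at most \<open>J\<close> are at
        least this far apart.\<close>
      show "0 < 1 / (2 * 3 ^ Suc J :: real)" by simp
      fix x y assume lt: "\<bar>s x - s y\<bar> < 1 / (2 * 3 ^ Suc J)"
      have agree: "x \<in> B j \<longleftrightarrow> y \<in> B j" if "j \<le> J" for j
      proof (rule ccontr)
        assume "\<not> (x \<in> B j \<longleftrightarrow> y \<in> B j)"
        \<comment> \<open>The first differing digit governs the distance of the codes; as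
          \<open>i \<le> j \<le> J\<close>, it pushes them too far apart.\<close>
        define i where "i = (LEAST i. \<not> (x \<in> B i \<longleftrightarrow> y \<in> B i))"
        have i: "\<not> (x \<in> B i \<longleftrightarrow> y \<in> B i)" and "i \<le> j"
          and below: "\<And>l. l < i \<Longrightarrow> x \<in> B l \<longleftrightarrow> y \<in> B l"
          unfolding i_def using \<open>\<not> (x \<in> B j \<longleftrightarrow> y \<in> B j)\<close>
          by (rule LeastI, rule Least_le, use not_less_Least in blast)
        define e :: "nat \<Rightarrow> real" where "e l = indicator (B l) x - indicator (B l) y" for l
        have "s x - s y = (\<Sum>l. e l / 3 ^ Suc l)"
          unfolding s_def e_def diff_divide_distrib
          by (rule suminf_diff; rule summable_ternary; rule ind)
        moreover have "1 / (2 * 3 ^ Suc i) \<le> \<bar>\<Sum>l. e l / 3 ^ Suc l\<bar>"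
          using i below by (intro ternary_first_digit) (auto simp: e_def indicator_def)
        moreover have "1 / (2 * 3 ^ Suc J) \<le> (1 / (2 * 3 ^ Suc i) :: real)"
          using \<open>i \<le> j\<close> \<open>j \<le> J\<close> by (intro divide_left_mono mult_left_mono power_increasing) auto
        ultimately show False using lt by linarith
      qed
      obtain j where "j \<le> J" "x \<in> B j" "B j \<subseteq> ball x \<epsilon>" using J by blast
      then show "dist x y < \<epsilon>" using agree by auto
    qed
  qed
qed

text \<open>A code \<open>y\<close> in the closure is a limit of codes of points, and compactness
  supplies a limit point of these points as the value at \<open>y\<close>. The closure is needed
  since \<open>range s\<close> need not be closed, and a weak limit of measures on
  \<open>range s\<close> can only be placed on its closure.\<close>

lemma uniformly_continuous_inverse_extension:
  fixes s :: "'a::metric_space \<Rightarrow> real"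
  assumes cpt: "compact (UNIV :: 'a set)"
    and uc: "\<And>\<epsilon>. \<epsilon> > 0 \<Longrightarrow> \<exists>\<delta>>0. \<forall>x y. \<bar>s x - s y\<bar> < \<delta> \<longrightarrow> dist x y < \<epsilon>"
  obtains \<phi> where "continuous_on (closure (range s)) \<phi>" "\<And>x. \<phi> (s x) = x"
proof -
  let ?C = "closure (range s)"
  have ex: "\<exists>z. \<forall>\<epsilon>>0. \<forall>\<eta>>0. \<exists>x. \<bar>s x - y\<bar> < \<epsilon> \<and> dist x z < \<eta>" if y: "y \<in> ?C" for y
  proof -
    obtain u where u: "\<And>n. u n \<in> range s" "u \<longlonglongrightarrow> y"
      using y unfolding closure_sequential by blast
    have "\<forall>n. \<exists>x. s x = u n" using u(1) by (metis rangeE)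
    then obtain x where x: "\<And>n. s (x n) = u n" by metis
    obtain z r where zr: "strict_mono (r :: nat \<Rightarrow> nat)" "(x \<circ> r) \<longlonglongrightarrow> z"
      using seq_compactE[of UNIV x] cpt unfolding compact_eq_seq_compact_metric by blast
    have u': "(\<lambda>n. s (x (r n))) \<longlonglongrightarrow> y"
      using LIMSEQ_subseq_LIMSEQ[OF u(2) zr(1)] x by (simp add: o_def)
    show ?thesis
    proof (rule exI, intro allI impI)
      fix \<epsilon> \<eta> :: real assume "\<epsilon> > 0" "\<eta> > 0"
      then have "eventually (\<lambda>n. dist (s (x (r n))) y < \<epsilon> \<and> dist ((x \<circ> r) n) z < \<eta>) sequentially"
        by (intro eventually_conj tendstoD[OF u'] tendstoD[OF zr(2)])
      then obtain n where "dist (s (x (r n))) y < \<epsilon> \<and> dist ((x \<circ> r) n) z < \<eta>"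
        using eventually_sequentially by auto
      then show "\<exists>x. \<bar>s x - y\<bar> < \<epsilon> \<and> dist x z < \<eta>" by (auto simp: dist_real_def)
    qed
  qed
  \<comment> \<open>Any such limit point may be chosen; the estimate \<open>key\<close> applies to
    every choice.\<close>
  define \<phi> where "\<phi> y = (SOME z. \<forall>\<epsilon>>0. \<forall>\<eta>>0. \<exists>x. \<bar>s x - y\<bar> < \<epsilon> \<and> dist x z < \<eta>)" for y
  have \<phi>: "\<exists>x. \<bar>s x - y\<bar> < \<epsilon> \<and> dist x (\<phi> y) < \<eta>" if "y \<in> ?C" "\<epsilon> > 0" "\<eta> > 0" for y \<epsilon> \<eta>
    using someI_ex[OF ex[OF that(1)]] that(2,3) unfolding \<phi>_def by blast
  have key: "\<exists>\<delta>>0. \<forall>y\<in>?C. \<forall>y'\<in>?C. \<bar>y - y'\<bar> < \<delta> \<longrightarrow> dist (\<phi> y) (\<phi> y') < \<epsilon>" if "\<epsilon> > 0" for \<epsilon>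
  proof -
    obtain \<delta> where \<delta>: "\<delta> > 0" "\<And>x y. \<bar>s x - s y\<bar> < \<delta> \<Longrightarrow> dist x y < \<epsilon> / 3"
      using uc[of "\<epsilon> / 3"] \<open>\<epsilon> > 0\<close> by auto
    \<comment> \<open>Two nearby codes are replaced by codes of actual points, each at a cost of
      \<open>\<delta> / 3\<close> in the code and \<open>\<epsilon> / 3\<close> in the
      space.\<close>
    have "dist (\<phi> y) (\<phi> y') < \<epsilon>" if yy: "y \<in> ?C" "y' \<in> ?C" "\<bar>y - y'\<bar> < \<delta> / 3" for y y'
    proof -
      obtain x x' where x: "\<bar>s x - y\<bar> < \<delta> / 3" "dist x (\<phi> y) < \<epsilon> / 3"
          "\<bar>s x' - y'\<bar> < \<delta> / 3" "dist x' (\<phi> y') < \<epsilon> / 3"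
        using \<phi>[OF yy(1), of "\<delta> / 3" "\<epsilon> / 3"] \<phi>[OF yy(2), of "\<delta> / 3" "\<epsilon> / 3"] \<open>\<delta> > 0\<close> \<open>\<epsilon> > 0\<close> by auto
      then have "dist x x' < \<epsilon> / 3" using yy(3) by (intro \<delta>(2)) linarith
      then show ?thesis
        using x dist_triangle[of "\<phi> y" "\<phi> y'" x] dist_triangle[of x "\<phi> y'" x']
        by (simp add: dist_commute)
    qed
    then show ?thesis using \<open>\<delta> > 0\<close> by (intro exI[of _ "\<delta> / 3"]) auto
  qed
  show ?thesis
  proof
    show "continuous_on ?C \<phi>"
      unfolding continuous_on_iff dist_real_def
    proof (intro ballI allI impI)
      fix y \<epsilon> assume "y \<in> ?C" "0 < (\<epsilon>::real)"
      then show "\<exists>d>0. \<forall>x'\<in>?C. \<bar>x' - y\<bar> < d \<longrightarrow> dist (\<phi> x') (\<phi> y) < \<epsilon>"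
        using key[of \<epsilon>] by blast
    qed
    show "\<phi> (s x) = x" for x
    proof -
      have sx: "s x \<in> ?C" by (simp add: closure_subset[THEN subsetD])
      have "dist x (\<phi> (s x)) \<le> \<epsilon>" if "\<epsilon> > 0" for \<epsilon>
      proof -
        obtain \<delta> where \<delta>: "\<delta> > 0" "\<And>x y. \<bar>s x - s y\<bar> < \<delta> \<Longrightarrow> dist x y < \<epsilon> / 2"
          using uc[of "\<epsilon> / 2"] \<open>\<epsilon> > 0\<close> by auto
        obtain x' where "\<bar>s x' - s x\<bar> < \<delta>" "dist x' (\<phi> (s x)) < \<epsilon> / 2"
          using \<phi>[OF sx \<delta>(1), of "\<epsilon> / 2"] \<open>\<epsilon> > 0\<close> by auto
        then show ?thesis
          using \<delta>(2)[of x' x] dist_triangle[of x "\<phi> (s x)" x'] by (simp add: dist_commute)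
      qed
      then have "dist x (\<phi> (s x)) \<le> 0" by (rule field_le_epsilon[of _ 0, simplified])
      then show ?thesis by simp
    qed
  qed
qed

text \<open>The measures are transported to the line by a Borel code with uniformly continuous inverse,
  so that Helly's theorem replaces the Riesz representation theorem.\<close>

lemma compact_weak_conv_subsequence:
  fixes N :: "nat \<Rightarrow> 'a::metric_space measure"
  assumes cpt: "compact (UNIV :: 'a set)"
    and prob: "\<And>n. prob_space (N n)" and sets: "\<And>n. sets (N n) = sets borel"
  obtains r \<nu> where "strict_mono r" "prob_space \<nu>" "sets \<nu> = sets borel" "weak_conv (\<lambda>n. N (r n)) \<nu>"
proof -
  obtain s :: "'a \<Rightarrow> real" where sm: "s \<in> borel_measurable borel" and sb: "\<And>x. \<bar>s x\<bar> \<le> 1 / 2"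
    and uc: "\<And>\<epsilon>. \<epsilon> > 0 \<Longrightarrow> \<exists>\<delta>>0. \<forall>x y. \<bar>s x - s y\<bar> < \<delta> \<longrightarrow> dist x y < \<epsilon>"
    using compact_Borel_code[OF cpt] by blast
  let ?C = "closure (range s)"
  obtain \<phi> where \<phi>c: "continuous_on ?C \<phi>" and \<phi>s: "\<And>x. \<phi> (s x) = x"
    using uniformly_continuous_inverse_extension[OF cpt uc] by blast
  have sN[measurable]: "s \<in> borel_measurable (N n)" for n
    using sm measurable_cong_sets[OF sets refl] by blast
  define P where "P n = distr (N n) borel s" for n
  have P: "real_distribution (P n)" for n
    unfolding P_def using prob sN
    by (intro prob_space.real_distribution_distr) auto
  \<comment> \<open>All codes lie in \<open>[-1/2, 1/2]\<close>, so one bounded interval carries the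
    full mass of every \<open>P n\<close>.\<close>
  have "tight P"
    unfolding tight_def
  proof (intro conjI allI impI P)
    fix \<epsilon> :: real assume "\<epsilon> > 0"
    have "measure (P n) {-1<..1} = 1" for n
    proof -
      interpret prob_space "N n" by (rule prob)
      have "s -` {-1<..1} = UNIV" 
      proof (intro set_eqI)
        show "x \<in> s -` {-1<..1} \<longleftrightarrow> x \<in> UNIV" for x using sb[of x] by auto
      qed
      then show ?thesis by (simp add: P_def measure_distr prob_space)
    qed
    then show "\<exists>a b. a < b \<and> (\<forall>n. 1 - \<epsilon> < measure (P n) {a<..b})"
      using \<open>\<epsilon> > 0\<close> by (intro exI[of _ "-1"] exI[of _ 1]) auto
  qed
  from tight_imp_convergent_subsubsequence[OF this strict_mono_id]
  obtain r \<rho> where r: "strict_mono (r :: nat \<Rightarrow> nat)" and \<rho>: "real_distribution \<rho>"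
    and wc: "weak_conv_m (P \<circ> r) \<rho>" by auto
  interpret \<rho>: real_distribution \<rho> by fact
  \<comment> \<open>Weak convergence on the line, pulled back to the space by the change of
    variables along \<open>s\<close>.\<close>
  have conv: "(\<lambda>n. \<integral>x. H (s x) \<partial>N (r n)) \<longlonglongrightarrow> (\<integral>y. H y \<partial>\<rho>)"
    if H: "continuous_on UNIV H" "\<And>y. norm (H y) \<le> c" for H :: "real \<Rightarrow> real" and c
  proof -
    have [measurable]: "H \<in> borel_measurable borel"
      using H(1) by (rule borel_measurable_continuous_onI)
    have "(\<lambda>n. integral\<^sup>L ((P \<circ> r) n) H) \<longlonglongrightarrow> integral\<^sup>L \<rho> H"
      by (rule weak_conv_imp_integral_bdd_continuous_conv[OF _ \<rho> wc _ H(2)])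
        (use P H(1) in \<open>auto simp: continuous_on_eq_continuous_at\<close>)
    then show ?thesis by (simp add: P_def integral_distr)
  qed
  have neC: "?C \<noteq> {}" by simp
  \<comment> \<open>The truncated distance to \<open>?C\<close> is bounded, continuous and zero on
    all codes. Its integral against the limit \<open>\<rho>\<close> therefore vanishes, which
    concentrates \<open>\<rho>\<close> on \<open>?C\<close>.\<close>
  have AEC: "AE y in \<rho>. y \<in> ?C"
  proof -
    let ?H = "\<lambda>y. min 1 (infdist y ?C)"
    have Hc: "continuous_on UNIV ?H" by (intro continuous_intros)
    have [measurable]: "?H \<in> borel_measurable borel"
      using Hc by (rule borel_measurable_continuous_onI)
    have "?H (s x) = 0" for x
      by (simp add: closure_subset[THEN subsetD])
    then have "(\<lambda>n. 0) \<longlonglongrightarrow> (\<integral>y. ?H y \<partial>\<rho>)"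
      using conv[OF Hc, of 1] infdist_nonneg[of _ ?C] by simp
    then have "(\<integral>y. ?H y \<partial>\<rho>) = 0" using LIMSEQ_unique tendsto_const by blast
    moreover have "integrable \<rho> ?H"
      by (rule \<rho>.integrable_const_bound[where B=1]) (auto simp: infdist_nonneg)
    ultimately have "AE y in \<rho>. ?H y = 0"
      by (subst (asm) integral_nonneg_eq_0_iff_AE) (auto simp: infdist_nonneg)
    then show ?thesis
    proof eventually_elim
      case (elim y)
      then have "infdist y ?C = 0" by (auto simp: min_def split: if_splits)
      then show ?case using in_closed_iff_infdist_zero[OF closed_closure neC] by blast
    qed
  qed
  \<comment> \<open>The constant value off \<open>?C\<close> makes the decoding map Borel on the
    whole line; it is taken only on a \<open>\<rho>\<close>-null set.\<close>
  define \<psi> where "\<psi> y = (if y \<in> ?C then \<phi> y else undefined)" for y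
  have \<psi>m[measurable]: "\<psi> \<in> borel \<rightarrow>\<^sub>M borel"
    unfolding \<psi>_def by (intro borel_measurable_continuous_on_if \<phi>c) auto
  define \<nu> where "\<nu> = distr \<rho> borel \<psi>"
  have \<psi>m': "\<psi> \<in> \<rho> \<rightarrow>\<^sub>M borel" using \<psi>m by measurable
  show ?thesis
  proof
    show "strict_mono r" by fact
    show "prob_space \<nu>" unfolding \<nu>_def using \<psi>m' by (rule \<rho>.prob_space_distr)
    show "sets \<nu> = sets borel" by (simp add: \<nu>_def)
    show "weak_conv (\<lambda>n. N (r n)) \<nu>"
      unfolding weak_conv_def
    proof (intro allI impI; elim conjE)
      fix h :: "'a \<Rightarrow> real" assume hc: "continuous_on UNIV h" and hb: "bounded (range h)"
      obtain c where c: "c > 0" "\<And>x. norm (h x) \<le> c" using hb unfolding bounded_pos by auto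
      \<comment> \<open>\<open>conv\<close> wants a test function on the whole line, so Tietze
        extends \<open>h \<circ> \<phi>\<close> from the closed set \<open>?C\<close> with the same
        bound. The extension gives back \<open>h\<close> on codes and agrees with
        \<open>h \<circ> \<psi>\<close> almost everywhere for \<open>\<rho>\<close>.\<close>
      have "continuous_on ?C (h \<circ> \<phi>)"
        using \<phi>c hc by (intro continuous_on_compose) (auto intro: continuous_on_subset)
      from Tietze[OF this, of UNIV c] c
      obtain H where H: "continuous_on UNIV H" "\<And>y. y \<in> ?C \<Longrightarrow> H y = (h \<circ> \<phi>) y" "\<And>y. norm (H y) \<le> c"
        by auto
      have "(\<integral>x. h x \<partial>\<nu>) = (\<integral>y. h (\<psi> y) \<partial>\<rho>)"
        unfolding \<nu>_def using \<psi>m' hc by (intro integral_distr borel_measurable_continuous_onI)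
      also have "\<dots> = (\<integral>y. H y \<partial>\<rho>)"
      proof (rule integral_cong_AE)
        show "(\<lambda>y. h (\<psi> y)) \<in> borel_measurable \<rho>"
          using hc \<psi>m' by (rule borel_measurable_continuous_on)
        show "H \<in> borel_measurable \<rho>"
          using borel_measurable_continuous_on[OF H(1) measurable_ident_sets[OF \<rho>.events_eq_borel]] by simp
        show "AE y in \<rho>. h (\<psi> y) = H y"
          using AEC by eventually_elim (simp add: \<psi>_def H(2))
      qed
      finally have "(\<integral>x. h x \<partial>\<nu>) = (\<integral>y. H y \<partial>\<rho>)" .
      moreover have "H (s x) = h x" for x
        using H(2)[of "s x"] \<phi>s by (simp add: closure_subset[THEN subsetD])
      ultimately show "(\<lambda>n. \<integral>x. h x \<partial>N (r n)) \<longlonglongrightarrow> (\<integral>x. h x \<partial>\<nu>)"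
        using conv[OF H(1,3)] by simp
    qed
  qed
qed

section \<open>Support of a measure and tent functions\<close>

text \<open>The topological support. For the weak limit it is the set \<open>A\<close> of the
  theorem; for \<open>mu\<close> it supplies the center of the competitor's ball.\<close>

definition msupport :: "'a::metric_space measure \<Rightarrow> 'a set" where
  "msupport N = {x. \<forall>\<epsilon>>0. 0 < measure N (ball x \<epsilon>)}"

text \<open>The fine cover replaces a countable base: the complement of the support is the union of
  those \<open>B j\<close> that are null sets, hence open and null.\<close>

lemma
  fixes N :: "'a::metric_space measure"
  assumes cpt: "compact (UNIV :: 'a set)" and prob: "prob_space N" and sets: "sets N = sets borel"
  shows sets_msupport: "msupport N \<in> sets borel"
    and emeasure_msupport: "emeasure N (msupport N) = 1"
proof -
  interpret prob_space N by (rule prob)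
  obtain B :: "nat \<Rightarrow> 'a set" where op: "\<And>j. open (B j)"
    and fine: "\<And>\<epsilon>. \<epsilon> > 0 \<Longrightarrow> \<exists>J. \<forall>x. \<exists>j\<le>J. x \<in> B j \<and> B j \<subseteq> ball x \<epsilon>"
    using compact_countable_fine_cover[OF cpt] by blast
  have opN: "U \<in> sets N" if "open U" for U using that sets by simp
  let ?Z = "{j. measure N (B j) = 0}"
  have eq: "- msupport N = (\<Union>j\<in>?Z. B j)"
  proof (intro set_eqI iffI)
    fix x assume "x \<in> - msupport N"
    then obtain \<epsilon> where \<epsilon>: "\<epsilon> > 0" "measure N (ball x \<epsilon>) = 0"
      unfolding msupport_def by (auto simp: not_less measure_le_0_iff)
    then obtain j where j: "x \<in> B j" "B j \<subseteq> ball x \<epsilon>" using fine by blast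
    then have "measure N (B j) \<le> measure N (ball x \<epsilon>)"
      by (intro finite_measure_mono opN) auto
    then have "measure N (B j) = 0" using \<epsilon>(2) measure_nonneg[of N "B j"] by linarith
    then show "x \<in> (\<Union>j\<in>?Z. B j)" using j by blast
  next
    fix x assume "x \<in> (\<Union>j\<in>?Z. B j)"
    then obtain j where j: "x \<in> B j" "measure N (B j) = 0" by blast
    then obtain \<epsilon> where \<epsilon>: "\<epsilon> > 0" "ball x \<epsilon> \<subseteq> B j" using op open_contains_ball by blast
    then have "measure N (ball x \<epsilon>) \<le> measure N (B j)"
      by (intro finite_measure_mono opN op) auto
    then show "x \<in> - msupport N" using \<epsilon>(1) j(2) unfolding msupport_def by (force simp: not_less)
  qed
  have "open (- msupport N)" unfolding eq using op by blast
  then have "closed (msupport N)" by (simp add: closed_def)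
  then show "msupport N \<in> sets borel" by simp
  then have S: "msupport N \<in> sets N" using sets by simp
  have "(\<Union>j\<in>?Z. B j) \<in> null_sets N"
    by (intro null_sets_UN') (auto simp: null_sets_def opN op emeasure_eq_measure)
  then have "AE x in N. x \<in> msupport N"
    unfolding eq[symmetric] by (auto dest: AE_not_in)
  then have "prob (msupport N) = 1"
    using prob_eq_1[OF S] by simp
  then show "emeasure N (msupport N) = 1" by (simp add: emeasure_eq_measure)
qed

lemma integrable_continuous_compact:
  fixes N :: "'a::metric_space measure" and h :: "'a \<Rightarrow> real"
  assumes "compact (UNIV :: 'a set)" "prob_space N" "sets N = sets borel" "continuous_on UNIV h"
  shows "integrable N h"
proof -
  interpret prob_space N by fact
  have "bounded (range h)"
    using assms by (intro compact_imp_bounded compact_continuous_image)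
  then obtain c where "\<And>x. norm (h x) \<le> c"
    by (auto simp: bounded_iff)
  moreover have "h \<in> borel_measurable N"
    using borel_measurable_continuous_onI[OF assms(4)] measurable_cong_sets[OF assms(3) refl] by blast
  ultimately show ?thesis by (intro integrable_const_bound) auto
qed

lemma prob_space_density_admissible:
  assumes "admissible mu f" shows "prob_space (density mu f)"
proof (rule prob_spaceI)
  have "emeasure (density mu f) (space (density mu f))
      = (\<integral>\<^sup>+ x. ennreal (f x) * indicator (space mu) x \<partial>mu)"
    using assms by (simp add: admissible_def emeasure_density)
  also have "\<dots> = (\<integral>\<^sup>+ x. ennreal (f x) \<partial>mu)"
    by (intro nn_integral_cong) simp
  finally show "emeasure (density mu f) (space (density mu f)) = 1"
    using assms by (simp add: admissible_def)
qed

text \<open>A continuous substitute for the indicator of \<open>ball p \<delta>\<close>, so that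
  weak convergence can be applied to it.\<close>

definition tent :: "real \<Rightarrow> 'a::metric_space \<Rightarrow> 'a \<Rightarrow> real" where
  "tent \<delta> p x = max 0 (\<delta> - dist x p)"

lemma tent_simps:
  assumes "0 < \<delta>"
  shows "0 \<le> tent \<delta> p x" "tent \<delta> p x \<le> \<delta>" "\<delta> \<le> dist x p \<Longrightarrow> tent \<delta> p x = 0"
  using assms by (auto simp: tent_def)

lemma continuous_tent: "continuous_on UNIV (tent \<delta> p)"
  unfolding tent_def by (intro continuous_intros)

text \<open>On the ball of half the radius the tent is at least \<open>\<delta> / 2\<close>, and
  this ball has positive mass because its center lies in the support.\<close>

lemma integral_tent_pos:
  fixes N :: "'a::metric_space measure"
  assumes cpt: "compact (UNIV :: 'a set)" and prob: "prob_space N" and sets: "sets N = sets borel"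
    and p: "p \<in> msupport N" and \<delta>: "0 < \<delta>"
  shows "0 < (\<integral>x. tent \<delta> p x \<partial>N)"
proof -
  interpret prob_space N by (rule prob)
  let ?B = "ball p (\<delta> / 2)"
  have B: "?B \<in> sets N" using sets by simp
  have "0 < \<delta> / 2 * measure N ?B"
    using p \<delta> unfolding msupport_def by simp
  also have "\<dots> = (\<integral>x. \<delta> / 2 * indicator ?B x \<partial>N)"
    using B by (simp add: sets_eq_imp_space_eq[OF sets])
  also have "\<dots> \<le> (\<integral>x. tent \<delta> p x \<partial>N)"
  proof (rule integral_mono)
    show "integrable N (\<lambda>x. \<delta> / 2 * indicator ?B x)"
      using B by (intro integrable_mult_right integrable_real_indicator) (auto simp: emeasure_eq_measure)
    show "integrable N (tent \<delta> p)"
      using cpt prob sets continuous_tent by (rule integrable_continuous_compact)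
    show "\<delta> / 2 * indicator ?B x \<le> tent \<delta> p x" for x
      using \<delta> by (auto simp: tent_def indicator_def dist_commute)
  qed
  finally show ?thesis .
qed

section \<open>Interaction energy of a Lipschitz kernel\<close>

text \<open>For \<open>N = density mu f\<close> this is the integral of \<open>U[f] f\<close> with
  respect to \<open>mu\<close>.\<close>

definition interaction :: "('a \<Rightarrow> 'a \<Rightarrow> real) \<Rightarrow> 'a measure \<Rightarrow> real" where
  "interaction k N = (\<integral>p. (\<integral>q. k p q \<partial>N) \<partial>N)"

locale lipschitz_kernel =
  fixes k :: "'a::metric_space \<Rightarrow> 'a \<Rightarrow> real" and L :: real
  assumes cpt: "compact (UNIV :: 'a set)"
    and nonneg: "\<And>p q. 0 \<le> k p q"
    and sym: "\<And>p q. k p q = k q p"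
    and diag: "\<And>p. k p p = 0"
    and L_pos: "0 < L"
    and lip: "\<And>p q s. \<bar>k p s - k q s\<bar> \<le> L * dist p q"
begin

lemma le_dist: "k p q \<le> L * dist p q"
  using lip[of p q q] diag by simp

lemma continuous_of_lipschitz:
  fixes h :: "'a \<Rightarrow> real"
  assumes "\<And>p q. \<bar>h p - h q\<bar> \<le> L * dist p q"
  shows "continuous_on UNIV h"
  using assms L_pos by (intro lipschitz_on_continuous_on[of L] lipschitz_onI) (auto simp: dist_real_def)

lemma continuous_kernel: "continuous_on UNIV (k p)"
  using lip by (intro continuous_of_lipschitz) (simp add: sym[of p])

context
  fixes N :: "'a measure"
  assumes prob: "prob_space N" and sets: "sets N = sets borel"
begin

lemma integrable_kernel: "integrable N (k p)"
  using cpt prob sets continuous_kernel by (rule integrable_continuous_compact)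

text \<open>The potential inherits the Lipschitz constant \<open>L\<close> of the kernel because
  \<open>N\<close> has total mass 1.\<close>

lemma continuous_potential: "continuous_on UNIV (\<lambda>p. \<integral>q. k p q \<partial>N)"
proof (rule continuous_of_lipschitz)
  interpret prob_space N by (rule prob)
  fix p q
  have "\<bar>(\<integral>s. k p s \<partial>N) - (\<integral>s. k q s \<partial>N)\<bar> = \<bar>\<integral>s. k p s - k q s \<partial>N\<bar>"
    by (simp add: integrable_kernel)
  also have "\<dots> \<le> (\<integral>s. \<bar>k p s - k q s\<bar> \<partial>N)"
    by (rule integral_abs_bound)
  also have "\<dots> \<le> L * dist p q"
    using lip by (intro integral_le_const integrable_abs Bochner_Integration.integrable_diff
        integrable_kernel) auto
  finally show "\<bar>(\<integral>s. k p s \<partial>N) - (\<integral>s. k q s \<partial>N)\<bar> \<le> L * dist p q" .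
qed

lemma integrable_potential: "integrable N (\<lambda>p. \<integral>q. k p q \<partial>N)"
  using cpt prob sets continuous_potential by (rule integrable_continuous_compact)

lemma interaction_nonneg: "0 \<le> interaction k N"
  unfolding interaction_def by (intro Bochner_Integration.integral_nonneg nonneg)

text \<open>Moving \<open>p\<close> and \<open>q\<close> by less than \<open>\<delta>\<close> lowers
  \<open>k\<close> by at most \<open>2 * L * \<delta> = k p q / 2\<close>, so at least
  \<open>k p q / 2\<close> remains, while the product of the tents is at most
  \<open>\<delta>\<^sup>2\<close>. The resulting pointwise bound is integrated. Its lower side is a
  product of single integrals, so it passes to weak limits without any convergence of product
  measures.\<close>

lemma interaction_ge_tent:
  assumes pq: "0 < k p q"
  defines "\<delta> \<equiv> k p q / (4 * L)"
  shows "k p q / (2 * \<delta>\<^sup>2) * ((\<integral>x. tent \<delta> p x \<partial>N) * (\<integral>y. tent \<delta> q y \<partial>N)) \<le> interaction k N"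
proof -
  define u where "u = k p q / (2 * \<delta>\<^sup>2)"
  have \<delta>: "0 < \<delta>" using pq L_pos by (simp add: \<delta>_def)
  have u: "0 < u" using pq \<delta> by (simp add: u_def)
  have it: "integrable N (tent \<delta> z)" for z
    using cpt prob sets continuous_tent by (rule integrable_continuous_compact)
  have ptw: "u * (tent \<delta> p x * tent \<delta> q y) \<le> k x y" for x y
  proof (cases "dist x p < \<delta> \<and> dist y q < \<delta>")
    case True
    have "L * dist x p \<le> L * \<delta>" "L * dist y q \<le> L * \<delta>" using True L_pos by auto
    moreover have "k p q - k x q \<le> L * dist x p" "k x q - k x y \<le> L * dist y q"
      using lip[where p=p and q=x and s=q] lip[where p=q and q=y and s=x] sym[of q x] sym[of y x] dist_commute[of p x] dist_commute[of q y]
      by simp_all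
    moreover have "L * \<delta> = k p q / 4" using L_pos by (simp add: \<delta>_def)
    ultimately have "k p q / 2 \<le> k x y" by linarith
    moreover have "u * (tent \<delta> p x * tent \<delta> q y) \<le> u * (\<delta> * \<delta>)"
      using u \<delta> tent_simps[OF \<delta>] by (intro mult_left_mono mult_mono) auto
    moreover have "u * (\<delta> * \<delta>) = k p q / 2" using \<delta> by (simp add: u_def power2_eq_square)
    ultimately show ?thesis by linarith
  next
    case False
    then show ?thesis using tent_simps(3)[OF \<delta>, of x p] tent_simps(3)[OF \<delta>, of y q] nonneg[of x y] by (auto simp: not_less)
  qed
  have "u * ((\<integral>x. tent \<delta> p x \<partial>N) * (\<integral>y. tent \<delta> q y \<partial>N))
      = (\<integral>x. (\<integral>y. u * (tent \<delta> p x * tent \<delta> q y) \<partial>N) \<partial>N)"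
    by simp
  also have "\<dots> \<le> (\<integral>x. (\<integral>y. k x y \<partial>N) \<partial>N)"
    using ptw by (intro integral_mono integrable_potential integrable_kernel)
      (auto intro: it)
  finally show ?thesis by (simp add: interaction_def u_def)
qed

end

section \<open>Energy bounds and the interaction of minimizers\<close>

context
  fixes mu :: "'a measure"
  assumes prob: "prob_space mu" and borel: "sets mu = sets borel"
begin

text \<open>Weighting by \<open>f\<close> under \<open>mu\<close> is integration against
  \<open>density mu f\<close>, so the quadratic term depends on \<open>f\<close> only through this
  measure.\<close>

lemma energy_eq_interaction:
  assumes f: "admissible mu f"
  shows "energy mu k b f =
     enn2ereal (\<integral>\<^sup>+ x. ennreal ((if f x = 0 then 0 else f x * ln (f x)) + 1) \<partial>mu) - 1
     + ereal (b / 2 * interaction k (density mu f))"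
proof -
  let ?N = "density mu f"
  have N: "prob_space ?N" "sets ?N = sets borel"
    using prob_space_density_admissible[OF f] borel by auto
  have fm: "f \<in> borel_measurable mu" and fn: "AE x in mu. 0 \<le> f x"
    using f unfolding admissible_def by auto
  have meas: "h \<in> borel_measurable mu" if "continuous_on UNIV h" for h :: "'a \<Rightarrow> real"
    using borel_measurable_continuous_onI[OF that] measurable_cong_sets[OF borel refl] by blast
  have pot: "pot mu k f = (\<lambda>p. \<integral>q. k p q \<partial>?N)"
    unfolding pot_def using integral_real_density[OF fm fn meas[OF continuous_kernel]]
    by (simp add: mult.commute)
  have "(\<integral>p. pot mu k f p * f p \<partial>mu) = interaction k ?N"
    unfolding interaction_def pot
    using integral_real_density[OF fm fn meas[OF continuous_potential[OF N]]]
    by (simp add: mult.commute)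
  then show ?thesis unfolding energy_def by simp
qed

text \<open>The entropy is a nonnegative extended integral minus 1, hence at least -1. A constant
  bound suffices, as it is negligible against \<open>b\<close>.\<close>

lemma energy_ge_interaction:
  assumes f: "admissible mu f"
  shows "ereal (b / 2 * interaction k (density mu f) - 1) \<le> energy mu k b f"
proof -
  have "0 - 1 + ereal (b / 2 * interaction k (density mu f)) \<le> energy mu k b f"
    unfolding energy_eq_interaction[OF f]
    by (intro add_right_mono ereal_minus_mono enn2ereal_nonneg) auto
  then show ?thesis by (simp add: one_ereal_def add.commute)
qed

text \<open>A function concentrated on a small ball has small interaction because \<open>k\<close>
  vanishes on the diagonal. Its entropy may be large, but it is finite and independent of
  \<open>b\<close>.\<close>

lemma low_energy_competitor:
  assumes "0 < \<eta>"
  obtains f K where "admissible mu f" "\<And>b. 0 < b \<Longrightarrow> energy mu k b f \<le> ereal (K + b * \<eta>)"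
proof -
  interpret prob_space mu by (rule prob)
  have "msupport mu \<noteq> {}"
    using emeasure_msupport[OF cpt prob borel] by auto
  then obtain p where p: "p \<in> msupport mu" by blast
  \<comment> \<open>Points of the ball are at distance at most \<open>2 * \<rho>\<close>, so
    \<open>k\<close> is at most \<open>2 * \<eta>\<close> there; the factor \<open>b / 2\<close>
    then yields \<open>b * \<eta>\<close>.\<close>
  define \<rho> where "\<rho> = \<eta> / L"
  have \<rho>: "0 < \<rho>" using assms L_pos by (simp add: \<rho>_def)
  define B where "B = ball p \<rho>"
  define m where "m = measure mu B"
  have m: "0 < m" using p \<rho> unfolding m_def B_def msupport_def by blast
  have B[measurable]: "B \<in> sets mu" using borel by (simp add: B_def)
  define f where "f x = indicator B x / m" for x
  have fm: "f \<in> borel_measurable mu" unfolding f_def by measurable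
  have "(\<integral>\<^sup>+ x. ennreal (f x) \<partial>mu) = (\<integral>\<^sup>+ x. ennreal (1 / m) * indicator B x \<partial>mu)"
    by (intro nn_integral_cong) (auto simp: f_def indicator_def)
  also have "\<dots> = ennreal (1 / m) * ennreal m"
    using B by (simp add: nn_integral_cmult_indicator emeasure_eq_measure m_def)
  also have "\<dots> = 1" using m by (simp add: ennreal_mult[symmetric])
  finally have adm: "admissible mu f"
    using fm m unfolding admissible_def by (auto simp: f_def)
  let ?N = "density mu f"
  have N: "prob_space ?N" "sets ?N = sets borel"
    using prob_space_density_admissible[OF adm] borel by auto
  interpret N: prob_space ?N by (rule N)
  have AEB: "AE x in ?N. x \<in> B"
    using fm by (subst AE_density) (auto simp: f_def indicator_def)
  have "(\<integral>y. k x y \<partial>?N) \<le> 2 * \<eta>" if "x \<in> B" for x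
  proof (rule N.integral_le_const[OF integrable_kernel[OF N]])
    show "AE y in ?N. k x y \<le> 2 * \<eta>"
      using AEB
    proof eventually_elim
      case (elim y)
      have "dist x y \<le> 2 * \<rho>"
        using elim that dist_triangle[of x y p] by (simp add: B_def dist_commute)
      then have "L * dist x y \<le> 2 * \<eta>" using L_pos by (simp add: \<rho>_def field_simps)
      then show ?case using le_dist[of x y] by linarith
    qed
  qed
  then have I: "interaction k ?N \<le> 2 * \<eta>"
    unfolding interaction_def using AEB
    by (intro N.integral_le_const integrable_potential[OF N]) auto
  \<comment> \<open>This dominates the shifted integrand, which is
    \<open>1 / m * ln (1 / m) + 1\<close> on \<open>B\<close> and 1 elsewhere. Undoing the shift
    makes \<open>K - 1\<close> the constant that is finally supplied.\<close>
  define K where "K = 1 / m * \<bar>ln (1 / m)\<bar> + 1"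
  have K: "0 \<le> K" using m by (simp add: K_def)
  define X where "X = (\<integral>\<^sup>+ x. ennreal ((if f x = 0 then 0 else f x * ln (f x)) + 1) \<partial>mu)"
  have "X \<le> (\<integral>\<^sup>+ x. ennreal K \<partial>mu)"
    unfolding X_def
  proof (intro nn_integral_mono ennreal_leI)
    fix x
    have "1 / m * ln (1 / m) \<le> 1 / m * \<bar>ln (1 / m)\<bar>"
      using m by (intro mult_left_mono) auto
    then show "(if f x = 0 then 0 else f x * ln (f x)) + 1 \<le> K"
      using m by (auto simp: f_def K_def indicator_def)
  qed
  then have "X \<le> ennreal K" by (simp add: emeasure_space_1)
  then have X: "enn2ereal X \<le> ereal K"
    using K by (metis enn2ereal_ennreal less_eq_ennreal.rep_eq)
  show ?thesis
  proof
    show "admissible mu f" by (rule adm)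
    fix b :: real assume b: "0 < b"
    have "energy mu k b f \<le> ereal K - 1 + ereal (b * \<eta>)"
      unfolding energy_eq_interaction[OF adm] X_def[symmetric]
      using X I b by (intro add_mono ereal_minus_mono) auto
    then show "energy mu k b f \<le> ereal ((K - 1) + b * \<eta>)" by (simp add: one_ereal_def)
  qed
qed

text \<open>Minimality against the competitor gives
  \<open>b / 2 * I - 1 \<le> K + b * \<eta>\<close>, so the interaction \<open>I\<close> is at most
  \<open>2 * (K + 1) / b + 2 * \<eta>\<close>. The first term vanishes in the limit, and
  \<open>\<eta>\<close> is arbitrary.\<close>

lemma interaction_minimizers_tendsto_0:
  fixes b :: "nat \<Rightarrow> real"
  assumes b_pos: "\<And>n. 0 < b n" and b_lim: "filterlim b at_top sequentially"
    and g_adm: "\<And>n. admissible mu (g n)"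
    and g_min: "\<And>n f. admissible mu f \<Longrightarrow> energy mu k (b n) (g n) \<le> energy mu k (b n) f"
  shows "(\<lambda>n. interaction k (density mu (g n))) \<longlonglongrightarrow> 0"
proof (rule order_tendstoI)
  have N: "prob_space (density mu (g n))" "sets (density mu (g n)) = sets borel" for n
    using prob_space_density_admissible[OF g_adm] borel by auto
  show "eventually (\<lambda>n. a < interaction k (density mu (g n))) sequentially" if "a < 0" for a
    using that interaction_nonneg[OF N] by (intro always_eventually allI) (auto intro: less_le_trans)
  fix \<epsilon> :: real assume "0 < \<epsilon>"
  \<comment> \<open>Once \<open>K + 1 < b n * \<eta>\<close>, the right-hand side is below
    \<open>2 * b n * \<eta> = b n / 2 * \<epsilon>\<close>.\<close>
  define \<eta> where "\<eta> = \<epsilon> / 4"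
  have \<eta>: "0 < \<eta>" using \<open>0 < \<epsilon>\<close> by (simp add: \<eta>_def)
  obtain f K where f: "admissible mu f" "\<And>b. 0 < b \<Longrightarrow> energy mu k b f \<le> ereal (K + b * \<eta>)"
    using low_energy_competitor[OF \<eta>] by blast
  have "eventually (\<lambda>n. (K + 1) / \<eta> < b n) sequentially"
    using b_lim by (simp add: filterlim_at_top_dense)
  then show "eventually (\<lambda>n. interaction k (density mu (g n)) < \<epsilon>) sequentially"
  proof eventually_elim
    case (elim n)
    let ?I = "interaction k (density mu (g n))"
    have "ereal (b n / 2 * ?I - 1) \<le> ereal (K + b n * \<eta>)"
      using energy_ge_interaction[OF g_adm] g_min[OF f(1)] f(2)[OF b_pos] by (meson order_trans)
    then have le: "b n / 2 * ?I \<le> K + 1 + b n * \<eta>" by simp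
    have "K + 1 < b n * \<eta>" using elim \<eta> by (simp add: pos_divide_less_eq)
    then have "b n / 2 * ?I < b n / 2 * \<epsilon>" using le by (simp add: \<eta>_def mult.commute)
    then show ?case using b_pos[of n] by simp
  qed
qed

end

end

section \<open>Vanishing of the kernel on the support of the weak limit\<close>

theorem theorem2:
  fixes mu :: "'a::metric_space measure"
    and k :: "'a \<Rightarrow> 'a \<Rightarrow> real"
    and b :: "nat \<Rightarrow> real"
    and g :: "nat \<Rightarrow> 'a \<Rightarrow> real"
  assumes compact: "compact (UNIV :: 'a set)"
    and prob: "prob_space mu"
    and borel: "sets mu = sets borel"
    and k_nonneg: "\<And>p q. 0 \<le> k p q"
    and k_sym: "\<And>p q. k p q = k q p"
    and k_diag: "\<And>p. k p p = 0"
    and k_lip: "\<exists>L>0. \<forall>p q s. \<bar>k p s - k q s\<bar> \<le> L * dist p q"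
    and b_pos: "\<And>n. 0 < b n"
    and b_lim: "filterlim b at_top sequentially"
    and g_adm: "\<And>n. admissible mu (g n)"
    and g_min: "\<And>n f. admissible mu f \<Longrightarrow> energy mu k (b n) (g n) \<le> energy mu k (b n) f"
  shows "\<exists>r \<nu> A. strict_mono r \<and> prob_space \<nu> \<and> sets \<nu> = sets borel
           \<and> weak_conv (\<lambda>n. density mu (g (r n))) \<nu>
           \<and> A \<in> sets borel \<and> emeasure \<nu> A = 1
           \<and> (\<forall>p\<in>A. \<forall>q\<in>A. k p q = 0)"
proof -
  obtain L where L: "0 < L" "\<And>p q s. \<bar>k p s - k q s\<bar> \<le> L * dist p q"
    using k_lip by blast
  interpret lipschitz_kernel k L
    using compact k_nonneg k_sym k_diag L by unfold_locales
  have N: "prob_space (density mu (g n))" "sets (density mu (g n)) = sets borel" for n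
    using prob_space_density_admissible[OF g_adm] borel by auto
  obtain r \<nu> where r: "strict_mono r" and \<nu>: "prob_space \<nu>" "sets \<nu> = sets borel"
    and wc: "weak_conv (\<lambda>n. density mu (g (r n))) \<nu>"
    using compact_weak_conv_subsequence[of "\<lambda>n. density mu (g n)", OF compact N] by blast
  have I0: "(\<lambda>n. interaction k (density mu (g (r n)))) \<longlonglongrightarrow> 0"
    using LIMSEQ_subseq_LIMSEQ[OF interaction_minimizers_tendsto_0[OF prob borel b_pos b_lim g_adm g_min] r]
    by (simp add: o_def)
  have "k p q = 0" if p: "p \<in> msupport \<nu>" and q: "q \<in> msupport \<nu>" for p q
  proof (rule ccontr)
    assume "k p q \<noteq> 0"
    then have pq: "0 < k p q" using k_nonneg[of p q] by simp
    \<comment> \<open>The radius and the factor \<open>c\<close> below are those of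
      \<open>interaction_ge_tent\<close>.\<close>
    define \<delta> where "\<delta> = k p q / (4 * L)"
    have \<delta>: "0 < \<delta>" using pq L by (simp add: \<delta>_def)
    define c where "c = k p q / (2 * \<delta>\<^sup>2)"
    have c: "0 < c" using pq \<delta> by (simp add: c_def)
    have bd: "bounded (range (tent \<delta> z))" for z :: 'a
      using tent_simps[OF \<delta>, of z] unfolding bounded_iff by (intro exI[of _ \<delta>]) auto
    have conv: "(\<lambda>n. \<integral>x. tent \<delta> z x \<partial>density mu (g (r n))) \<longlonglongrightarrow> (\<integral>x. tent \<delta> z x \<partial>\<nu>)" for z
      using wc bd continuous_tent unfolding weak_conv_def by blast
    \<comment> \<open>For each \<open>n\<close> the tent product is bounded by the interaction.
      Passing to the limit, the left side converges by weak convergence and the right side tends to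
      0.\<close>
    have "c * ((\<integral>x. tent \<delta> p x \<partial>\<nu>) * (\<integral>y. tent \<delta> q y \<partial>\<nu>)) \<le> 0"
    proof (rule LIMSEQ_le)
      show "(\<lambda>n. c * ((\<integral>x. tent \<delta> p x \<partial>density mu (g (r n))) * (\<integral>y. tent \<delta> q y \<partial>density mu (g (r n)))))
        \<longlonglongrightarrow> c * ((\<integral>x. tent \<delta> p x \<partial>\<nu>) * (\<integral>y. tent \<delta> q y \<partial>\<nu>))"
        by (intro tendsto_intros conv)
    qed (use I0 interaction_ge_tent[OF N pq] in \<open>auto simp: c_def \<delta>_def\<close>)
    moreover have "0 < (\<integral>x. tent \<delta> p x \<partial>\<nu>)" "0 < (\<integral>y. tent \<delta> q y \<partial>\<nu>)"
      using integral_tent_pos[OF compact \<nu> _ \<delta>] p q by auto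
    ultimately show False using c by (simp add: mult_le_0_iff not_less)
  qed
  \<comment> \<open>The witness for \<open>A\<close> is \<open>msupport \<nu>\<close>.\<close>
  then show ?thesis
    using r \<nu> wc sets_msupport[OF compact \<nu>] emeasure_msupport[OF compact \<nu>] by blast
qed

end
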